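(* For each $x\in\widehat{\mathbb{R}}$, the monad $m_{\approx}(x)$ has the same cardinal as $\widehat{\mathbb{R}}$.
   Context: $\widehat{\mathbb{R}}$ is the set of all convergent sequences of real numbers. For $x\in\widehat{\mathbb{R}}$, $\sigma x\in\mathbb{R}$ denotes its limit, $x\approx y$ means $\sigma x=\sigma y$, and $m_{\approx}(x):=\{y\in\widehat{\mathbb{R}}\mid y\approx x\}$. *)

theory Defs
  imports Complex_Main "HOL-Library.Equipollence"
begin

definition conv_seqs :: "(nat \<Rightarrow> real) set" where
  "conv_seqs = {x. convergent x}"

(* Meaningful only on conv_seqs: lim is unspecified for a divergent sequence. *)
definition seq_limit :: "(nat \<Rightarrow> real) \<Rightarrow> real" where
  "seq_limit x = lim x"

(* The library's infix \<approx> denotes equipollence (eqpoll), so the paper's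
   relation "same limit" gets a name instead of that symbol. *)
definition same_limit :: "(nat \<Rightarrow> real) \<Rightarrow> (nat \<Rightarrow> real) \<Rightarrow> bool" where
  "same_limit x y \<longleftrightarrow> seq_limit x = seq_limit y"

definition monad :: "(nat \<Rightarrow> real) \<Rightarrow> (nat \<Rightarrow> real) set" where
  "monad x = {y \<in> conv_seqs. same_limit y x}"

end

(* Storing the limit of y as a new zeroth term frees its limit: the sequence
   lim y, y 0 - lim y + L, y 1 - lim y + L, ... determines y and converges to L. *)
theory Submission
  imports Defs
begin

text \<open>The monad of \<open>x\<close> consists of the sequences tending to \<open>lim x\<close>,
  so it suffices to biject the sequences tending to a fixed \<open>L\<close> with all convergent
  ones. Recentring a sequence at \<open>L\<close> loses one real number, its old limit; a shift by
  one place makes room for that number and leaves the limit unchanged.\<close>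

lemma eqpoll_tendsto_conv_seqs:
  fixes L :: real
  shows "eqpoll {z. z \<longlonglongrightarrow> L} conv_seqs"
proof -
  let ?f = "\<lambda>(z :: nat \<Rightarrow> real) n. z (Suc n) - L + z 0"
  let ?g = "\<lambda>y :: nat \<Rightarrow> real. case_nat (lim y) (\<lambda>n. y n - lim y + L)"
  have f: "?f z \<longlonglongrightarrow> z 0" if "z \<longlonglongrightarrow> L" for z
    using tendsto_add[OF tendsto_diff[OF LIMSEQ_Suc[OF that] tendsto_const] tendsto_const, of L "z 0"]
    by simp
  have g: "?g y \<longlonglongrightarrow> L" if "convergent y" for y
  proof (rule LIMSEQ_imp_Suc)
    have "y \<longlonglongrightarrow> lim y"
      using that by (simp add: convergent_LIMSEQ_iff)
    from tendsto_add[OF tendsto_diff[OF this tendsto_const] tendsto_const, of "lim y" L]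
    show "(\<lambda>n. ?g y (Suc n)) \<longlonglongrightarrow> L"
      by simp
  qed
  have "bij_betw ?f {z. z \<longlonglongrightarrow> L} conv_seqs"
  proof (rule bij_betw_byWitness[where f' = ?g])
    \<comment> \<open>\<open>?g\<close> recovers the zeroth term because \<open>z 0\<close> is the
      limit of \<open>?f z\<close>; the other terms then cancel.\<close>
    show "\<forall>z\<in>{z. z \<longlonglongrightarrow> L}. ?g (?f z) = z"
      using limI[OF f] by (auto simp: fun_eq_iff split: nat.split)
    show "\<forall>y\<in>conv_seqs. ?f (?g y) = y"
      by simp
    show "?f ` {z. z \<longlonglongrightarrow> L} \<subseteq> conv_seqs"
      using f by (auto simp: conv_seqs_def convergent_def)
    show "?g ` conv_seqs \<subseteq> {z. z \<longlonglongrightarrow> L}"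
      using g by (auto simp: conv_seqs_def)
  qed
  then show ?thesis
    unfolding eqpoll_def by blast
qed

theorem proposition4p1:
  fixes x :: "nat \<Rightarrow> real"
  assumes "x \<in> conv_seqs"
  shows "eqpoll (monad x) conv_seqs"
proof -
  \<comment> \<open>For a convergent sequence \<open>lim\<close> is a true limit, so having the same
    \<open>lim\<close> as \<open>x\<close> amounts to tending to \<open>lim x\<close>.\<close>
  have "monad x = {z. z \<longlonglongrightarrow> lim x}"
    unfolding monad_def conv_seqs_def same_limit_def seq_limit_def
    by (metis (lifting) convergent_LIMSEQ_iff convergentI limI mem_Collect_eq)
  then show ?thesis
    by (simp add: eqpoll_tendsto_conv_seqs)
qed

end
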